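(* Let $S$ be the set of all triples $(x,y,z)$ of positive integers satisfying $$x^{yz} = y^{xz}.$$ Then $S = S_1 \cup S_2 \cup S_3 \cup S_4 \cup S_5 \cup S_6 \cup S_7$, where $$S_1 = \{(1,1,c) : c \in \mathbb{Z}^+\},$$ $$S_2 = \{(a,a,1) : a \in \mathbb{Z}^+,\ a \geq 2\},$$ $$S_3 = \{(4,2,1)\},$$ $$S_4 = \{(2,4,1)\},$$ $$S_5 = \{(a,a,c) : a,c \in \mathbb{Z}^+,\ a \geq 2,\ c \geq 2\},$$ $$S_6 = \{(4,2,c) : c \in \mathbb{Z}^+,\ c \geq 2\},$$ $$S_7 = \{(2,4,c) : c \in \mathbb{Z}^+,\ c \geq 2\}.$$
   Context: $\mathbb{Z}^+$ denotes the set of positive integers. The exponents $yz$ and $xz$ are products. *)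

theory Defs
  imports Complex_Main
begin

end

theory Submission
  imports Defs
begin

text \<open>Since \<open>x ^ (y * z) = (x ^ y) ^ z\<close>, the exponent \<open>z\<close> cancels and the equation is
  \<open>x ^ y = y ^ x\<close>. If \<open>x < y\<close>, then \<open>x ^ x\<close> divides \<open>x ^ y = y ^ x\<close>, so \<open>y = x * k\<close>; taking
  \<open>x\<close>-th roots gives \<open>x ^ (k - 1) = k\<close>, and the left side grows too fast unless \<open>k = x = 2\<close>.\<close>

lemma less_two_power_pred:
  fixes k :: nat
  assumes "k > 2"
  shows "k < 2 ^ (k - 1)"
proof -
  \<comment> \<open>Writing \<open>k\<close> as \<open>n + 3\<close> removes the truncated
    subtraction, so plain induction applies.\<close>
  have "n + 3 < 2 ^ (n + 2)" for n :: nat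
    by (induction n) auto
  moreover obtain n where "k = n + 3"
    using assms by (metis Suc_leI add.commute eval_nat_numeral(3) le_Suc_ex)
  ultimately show ?thesis
    by simp
qed

lemma power_commute_less_imp:
  fixes x y :: nat
  assumes eq: "x ^ y = y ^ x" and "0 < x" "x < y"
  shows "x = 2 \<and> y = 4"
proof -
  have "x \<noteq> 1"
    using assms by auto
  hence x2: "x \<ge> 2"
    using \<open>0 < x\<close> by simp
  have "x ^ x dvd y ^ x"
    using \<open>x < y\<close> by (simp flip: eq add: le_imp_power_dvd)
  hence "x dvd y"
    using \<open>0 < x\<close> by simp
  then obtain k where y: "y = x * k" ..
  have k2: "k \<ge> 2"
  proof (rule ccontr)
    assume "\<not> k \<ge> 2"
    hence "k = 0 \<or> k = 1" by auto
    thus False using y \<open>x < y\<close> by auto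
  qed
  \<comment> \<open>With \<open>y = x * k\<close> both sides of \<open>eq\<close> become
    \<open>x\<close>-th powers, so their bases can be compared.\<close>
  have "(x ^ k) ^ x = (x * k) ^ x"
    using eq by (simp add: y mult.commute flip: power_mult)
  hence "x ^ k = x * k"
    using \<open>0 < x\<close> by (simp add: power_eq_iff_eq_base)
  moreover have "x ^ k = x * x ^ (k - 1)"
    using k2 by (simp flip: power_Suc)
  ultimately have root: "x ^ (k - 1) = k"
    using \<open>0 < x\<close> by simp
  have "2 ^ (k - 1) \<le> k"
    using power_mono[OF x2, of "k - 1"] root by simp
  hence "k = 2"
    using less_two_power_pred[of k] k2 by linarith
  \<comment> \<open>For \<open>k = 2\<close>, \<open>root\<close> reads
    \<open>x ^ 1 = 2\<close>.\<close>
  with root y show ?thesis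
    by simp
qed

text \<open>The equation is symmetric, so the case \<open>y < x\<close> is the case
  \<open>x < y\<close> with the variables swapped.\<close>

lemma power_commute_iff:
  fixes x y :: nat
  assumes "0 < x" "0 < y"
  shows "x ^ y = y ^ x \<longleftrightarrow> x = y \<or> x = 2 \<and> y = 4 \<or> x = 4 \<and> y = 2"
proof
  assume "x ^ y = y ^ x"
  thus "x = y \<or> x = 2 \<and> y = 4 \<or> x = 4 \<and> y = 2"
    using power_commute_less_imp[of x y] power_commute_less_imp[of y x] assms
    by (metis linorder_neqE_nat)
qed auto

theorem theorem4:
  shows "{(x :: nat, y :: nat, z :: nat). x > 0 \<and> y > 0 \<and> z > 0 \<and> x ^ (y * z) = y ^ (x * z)} =
    {(1, 1, c) | c. c > 0}
    \<union> {(a, a, 1) | a. a > 0 \<and> a \<ge> 2}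
    \<union> {(4, 2, 1)}
    \<union> {(2, 4, 1)}
    \<union> {(a, a, c) | a c. a > 0 \<and> c > 0 \<and> a \<ge> 2 \<and> c \<ge> 2}
    \<union> {(4, 2, c) | c. c > 0 \<and> c \<ge> 2}
    \<union> {(2, 4, c) | c. c > 0 \<and> c \<ge> 2}"
proof -
  have *: "x ^ (y * z) = y ^ (x * z) \<longleftrightarrow> x = y \<or> x = 2 \<and> y = 4 \<or> x = 4 \<and> y = 2"
    if "x > 0" "y > 0" "z > 0" for x y z :: nat
    using that by (simp add: power_mult power_eq_iff_eq_base power_commute_iff)
  have one: "n = 1 \<or> n \<ge> 2" if "n > 0" for n :: nat
    using that by auto
  show ?thesis
    \<comment> \<open>The seven families split on whether \<open>a\<close> and \<open>c\<close>
      equal 1, which \<open>one\<close> decides; \<open>conj_cong\<close> lets the positivity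
      conjuncts discharge the premises of \<open>*\<close>.\<close>
    by (rule set_eqI) (use one in \<open>auto simp: * cong: conj_cong\<close>)
qed

end
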